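(* Let $(\Omega,\mathcal{F},\mathbb{P})$, $X$, $X^{(N)}$, $\Omega_0$, $\Gamma^{(N)}$ and $\Gamma$ be as described in the context: $X=(X(t))_{t\in\mathbb{R}}$ is a strictly increasing Lévy process, and $\Gamma^{(N)}(\omega;\tau;x,t)=X^{(N)}\big(\omega;\tau+(X^{(N)}(\omega))^{-1}(x)-t\big)$, $\Gamma(\omega;\tau;x,t)=X\big(\omega;\tau+X(\omega)^*(x)-t\big)$. Let $\lambda$ be Lebesgue measure on $\mathbb{R}^2$. (1) For every $\omega\in\Omega_0$ and for $\lambda$-almost every $(x,t)\in\mathbb{R}^2$, $$\Gamma^{(N)}(\omega;0;x,t)\to\Gamma(\omega;0;x,t)\quad\text{as } N\to\infty.$$ (2) Let $u_0:\mathbb{R}\to\mathbb{R}$ be bounded and continuous, $1\le p<\infty$, and $K\subseteq\mathbb{R}^2$ compact. Then for every $\omega\in\Omega_0$, $$\int_K\left|u_0\big(\Gamma^{(N)}(\omega;0;x,t)\big)-u_0\big(\Gamma(\omega;0;x,t)\big)\right|^p\,\mathrm{d}\lambda(x,t)\to 0\quad\text{as } N\to\infty.$$ (3) $\Gamma^{(N)}(\omega;0;x,t)\to\Gamma(\omega;0;x,t)$ as $N\to\infty$ for $\mathbb{P}\otimes\lambda$-almost every $(\omega,x,t)\in\Omega\times\mathbb{R}^2$. (4) Let $u_0:\mathbb{R}\to\mathbb{R}$ be bounded and continuous, $1\le p<\infty$, and $K\subseteq\mathbb{R}^2$ compact. Then $$\int_{\Omega\times K}\left|u_0\big(\Gamma^{(N)}(\omega;0;x,t)\big)-u_0\big(\Gamma(\omega;0;x,t)\big)\right|^p\,\mathrm{d}(\mathbb{P}\otimes\lambda)(\omega,x,t)\to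 0\quad\text{as } N\to\infty.$$
   Context: Setting. Let $(\Omega,\mathcal{F},\mathbb{P})$ be a probability space and $X=(X(t))_{t\in\mathbb{R}}$ a (two-sided, real-valued) Lévy process on it, i.e. $X(0)=0$, $X$ has independent and stationary increments, is continuous in probability, and has almost surely càdlàg paths (right-continuous with left limits). It is assumed that the increments of $X$ over intervals of positive length are positive, so that almost surely the path $t\mapsto X(\omega;t)$ is strictly increasing with $X(\omega;t)\to\pm\infty$ as $t\to\pm\infty$. Let $\Omega_0\in\mathcal{F}$ with $\mathbb{P}(\Omega_0)=1$ be an event such that for every $\omega\in\Omega_0$ the path $X(\omega;\cdot)$ is càdlàg, strictly increasing and tends to $\pm\infty$ as $t\to\pm\infty$. For $N\in\mathbb{N}$ and $k\in\mathbb{Z}$ let $t_k^{(N)}=k/2^N$. For $\omega\in\Omega_0$, $X^{(N)}(\omega;\cdot):\mathbb{R}\to\mathbb{R}$ is the continuous piecewise affine interpolation of $X(\omega;\cdot)$ at the grid points: it is affine on each $[t_{k-1}^{(N)},t_k^{(N)}]$ and $X^{(N)}(\omega;t_k^{(N)})=X(\omega;t_k^{(N)})$ for all $k\in\mathbb{Z}$. It is a strictly increasing bijection of $\mathbb{R}$, with inverse denoted $(X^{(N)}(\omega))^{-1}$. Further, $$X(\omega)^*(x)=\inf\{t\in\mathbb{R}: X(\omega;t)\ge x\},\quad x\in\mathbb{R}.$$ For $\omega\in\Omega_0$ and $\tau,x,t\in\mathbb{R}$, the characteristic curves are $$\Gamma^{(N)}(\omega;\tau;x,t)=X^{(N)}\big(\omega;\tau+(X^{(N)}(\omega))^{-1}(x)-t\big),\qquad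 \Gamma(\omega;\tau;x,t)=X\big(\omega;\tau+X(\omega)^*(x)-t\big).$$ They are defined for $\omega\in\Omega_0$, hence for almost every $\omega\in\Omega$. *)

theory Defs
  imports "HOL-Probability.Probability"
begin

definition cadlag :: "(real \<Rightarrow> real) \<Rightarrow> bool" where
  "cadlag f \<longleftrightarrow> (\<forall>t. continuous (at_right t) f \<and> (\<exists>l. (f \<longlongrightarrow> l) (at_left t)))"

(* Two-sided real-valued Levy process; as usual, X(0) = 0 is only required almost surely. *)
locale levy_process = prob_space M for M :: "'a measure" +
  fixes X :: "real \<Rightarrow> 'a \<Rightarrow> real"
  assumes random_variable_X: "\<And>t. random_variable borel (X t)"
    and start_zero: "AE \<omega> in M. X 0 \<omega> = 0"
    and independent_increments:
      "\<And>(n::nat) (t :: nat \<Rightarrow> real). (\<And>i. i < n \<Longrightarrow> t i < t (Suc i)) \<Longrightarrow>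
         indep_vars (\<lambda>_. borel) (\<lambda>i \<omega>. X (t (Suc i)) \<omega> - X (t i) \<omega>) {..<n}"
    and stationary_increments:
      "\<And>s t h. s < t \<Longrightarrow>
         distr M borel (\<lambda>\<omega>. X (t + h) \<omega> - X (s + h) \<omega>) = distr M borel (\<lambda>\<omega>. X t \<omega> - X s \<omega>)"
    and continuous_in_probability:
      "\<And>t \<epsilon>. \<epsilon> > 0 \<Longrightarrow>
         ((\<lambda>s. prob {\<omega> \<in> space M. \<bar>X s \<omega> - X t \<omega>\<bar> > \<epsilon>}) \<longlongrightarrow> 0) (at t)"
    and cadlag_paths: "AE \<omega> in M. cadlag (\<lambda>t. X t \<omega>)"

definition grid :: "nat \<Rightarrow> int \<Rightarrow> real" where
  "grid N k = of_int k / 2 ^ N"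

(* The cell containing t is [grid N k, grid N (k + 1)] with k = \<lfloor>2 ^ N * t\<rfloor>, and it has
   length 1 / 2 ^ N; interpolant_affine gives the formula on every closed cell. *)
definition interpolant :: "nat \<Rightarrow> (real \<Rightarrow> real) \<Rightarrow> real \<Rightarrow> real" where
  "interpolant N f t =
     (let k = \<lfloor>2 ^ N * t\<rfloor>
      in f (grid N k) + 2 ^ N * (t - grid N k) * (f (grid N (k + 1)) - f (grid N k)))"

lemma interpolant_grid: "interpolant N f (grid N k) = f (grid N k)"
  by (simp add: interpolant_def grid_def)

lemma interpolant_affine:
  assumes "t \<in> {grid N (k - 1)..grid N k}"
  shows "interpolant N f t =
    f (grid N (k - 1)) + 2 ^ N * (t - grid N (k - 1)) * (f (grid N k) - f (grid N (k - 1)))"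
proof (cases "t = grid N k")
  case True
  have "(2::real) ^ N * (grid N k - grid N (k - 1)) = 1"
    by (simp add: grid_def field_simps)
  then show ?thesis
    by (simp add: True interpolant_grid)
next
  case False
  with assms have "t < grid N k" "grid N (k - 1) \<le> t"
    by auto
  then have "of_int (k - 1) \<le> 2 ^ N * t" "2 ^ N * t < of_int k"
    by (simp_all add: grid_def field_simps)
  then have "\<lfloor>2 ^ N * t\<rfloor> = k - 1"
    by (intro floor_unique) auto
  then show ?thesis
    by (simp add: interpolant_def Let_def)
qed

definition generalized_inverse :: "(real \<Rightarrow> real) \<Rightarrow> real \<Rightarrow> real" where
  "generalized_inverse f x = Inf {t. f t \<ge> x}"

(* The characteristic curves are functions of a single path f, namely f = X(\<omega>; _).
   The values of inv and Inf are only meaningful for paths that are strictly increasing and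
   tend to \<plusminus>\<infinity>; over a product with the probability space, integrals are therefore taken over
   the set of good \<omega>, whose complement is null. *)
definition Gamma_N :: "nat \<Rightarrow> (real \<Rightarrow> real) \<Rightarrow> real \<Rightarrow> real \<Rightarrow> real \<Rightarrow> real" where
  "Gamma_N N f \<tau> x t = interpolant N f (\<tau> + inv (interpolant N f) x - t)"

definition Gamma_lim :: "(real \<Rightarrow> real) \<Rightarrow> real \<Rightarrow> real \<Rightarrow> real \<Rightarrow> real" where
  "Gamma_lim f \<tau> x t = f (\<tau> + generalized_inverse f x - t)"

end

theory Submission
  imports Defs
begin

text \<open>Everything is pathwise. At a dyadic point the interpolants eventually agree with the path \<open>f\<close>,
  so monotonicity squeezes them between nearby dyadic values: the inverses of the interpolants
  converge everywhere to the generalized inverse, and the interpolants converge along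
  \<open>s N \<longlonglongrightarrow> r\<close> whenever \<open>f\<close> is continuous at \<open>r\<close>. For fixed \<open>x\<close>, convergence of the characteristic
  curves can thus only fail when \<open>generalized_inverse f x - t\<close> is one of the countably many jumps
  of \<open>f\<close>. Fubini's theorem and dominated convergence then give all four claims; right-continuity
  is only needed for joint measurability in \<open>\<omega>\<close>, \<open>x\<close> and \<open>t\<close>.\<close>

section \<open>Nested dyadic grids\<close>

lemma interpolant_grid_refine:
  assumes "m \<le> N"
  shows "interpolant N f (grid m k) = f (grid m k)"
proof -
  obtain j where "N = m + j"
    using assms le_Suc_ex by blast
  then have "grid m k = grid N (k * 2 ^ j)"
    by (simp add: grid_def power_add)
  then show ?thesis
    by (simp add: interpolant_grid)
qed

text \<open>Rounding up by floor plus one, rather than by the ceiling, gives a point strictly to the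
  right of \<open>t\<close> even when \<open>t\<close> lies on the grid. This strictness serves both
  density and the approximation of \<open>t\<close> from the right.\<close>

lemma grid_floor_bounds:
  fixes t :: real
  shows "t < grid N (\<lfloor>2 ^ N * t\<rfloor> + 1)" "grid N (\<lfloor>2 ^ N * t\<rfloor> + 1) \<le> t + (1 / 2) ^ N"
proof -
  define k where "k = \<lfloor>2 ^ N * t\<rfloor> + 1"
  have k: "2 ^ N * t < of_int k" "of_int k \<le> 2 ^ N * t + 1"
    unfolding k_def by linarith+
  show "t < grid N (\<lfloor>2 ^ N * t\<rfloor> + 1)"
    using k(1) unfolding k_def[symmetric] by (simp add: grid_def field_simps)
  show "grid N (\<lfloor>2 ^ N * t\<rfloor> + 1) \<le> t + (1 / 2) ^ N"
    using k(2) unfolding k_def[symmetric] by (simp add: grid_def field_simps)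
qed

lemma grid_dense:
  assumes "a < b"
  obtains m k where "a < grid m k" "grid m k < b"
proof -
  obtain m where "(1 / 2) ^ m < b - a"
    using real_arch_pow_inv[of "b - a" "1 / 2"] assms by auto
  then show ?thesis
    using that grid_floor_bounds[where t = a and N = m] by force
qed

section \<open>A single increasing path: its generalized inverse, its interpolants and their
  limits\<close>

locale increasing_path =
  fixes f :: "real \<Rightarrow> real"
  assumes strict: "strict_mono f"
    and top: "filterlim f at_top at_top"
    and bot: "filterlim f at_bot at_bot"
begin

lemma le_iff: "f s \<le> f t \<longleftrightarrow> s \<le> t"
  using strict by (rule strict_mono_less_eq)

lemma less_iff: "f s < f t \<longleftrightarrow> s < t"
  using strict by (rule strict_mono_less)

text \<open>The limits at plus and minus infinity make the set under \<open>Inf\<close> nonempty and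
  bounded below, so \<open>Inf\<close> is a genuine infimum. All later facts about the generalized
  inverse rest on this equivalence.\<close>

lemma generalized_inverse_less_iff:
  "generalized_inverse f x < s \<longleftrightarrow> (\<exists>t<s. x \<le> f t)"
proof -
  have "\<forall>\<^sub>F t in at_top. x \<le> f t"
    using top by (simp add: filterlim_at_top)
  then have ne: "{t. x \<le> f t} \<noteq> {}"
    by (auto simp: eventually_at_top_linorder)
  have "\<forall>\<^sub>F t in at_bot. f t < x"
    using bot by (simp add: filterlim_at_bot_dense)
  then obtain u where u: "\<And>t. t \<le> u \<Longrightarrow> f t < x"
    by (auto simp: eventually_at_bot_linorder)
  have "bdd_below {t. x \<le> f t}"
  proof (rule bdd_belowI)
    show "u \<le> t" if "t \<in> {t. x \<le> f t}" for t
      using u[of t] that by force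
  qed
  from cInf_less_iff[OF ne this] show ?thesis
    by (auto simp: generalized_inverse_def)
qed

lemma less_of_less_generalized_inverse:
  assumes "t < generalized_inverse f x"
  shows "f t < x"
proof (rule ccontr)
  assume "\<not> f t < x"
  \<comment> \<open>The equivalence needs a witness strictly below its bound, so it is applied at an
    intermediate \<open>u\<close> instead of at the infimum.\<close>
  obtain u where "t < u" "u < generalized_inverse f x"
    using assms dense by blast
  with \<open>\<not> f t < x\<close> have "generalized_inverse f x < u"
    by (auto simp: generalized_inverse_less_iff intro!: exI[of _ t])
  with \<open>u < generalized_inverse f x\<close> show False
    by simp
qed

lemma less_of_generalized_inverse_less:
  assumes "generalized_inverse f x < t"
  shows "x < f t"
proof -
  obtain u where "u < t" "x \<le> f u"
    using assms generalized_inverse_less_iff by blast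
  then show ?thesis
    using strict_monoD[OF strict, of u t] by simp
qed

lemma generalized_inverse_mono: "mono (generalized_inverse f)"
proof (rule monoI, rule ccontr)
  fix x y assume "x \<le> y" "\<not> generalized_inverse f x \<le> generalized_inverse f y"
  then have "generalized_inverse f y < generalized_inverse f x"
    by simp
  then obtain t where "t < generalized_inverse f x" "y \<le> f t"
    using generalized_inverse_less_iff by blast
  with less_of_less_generalized_inverse[OF this(1)] \<open>x \<le> y\<close> show False
    by simp
qed

text \<open>Within one cell the interpolant is affine with positive slope; for points in different
  cells, the value at the left end of the later cell separates the two.\<close>

lemma interpolant_strict_mono: "strict_mono (interpolant N f)"
proof (rule strict_monoI)
  fix s t :: real assume "s < t"
  define c :: real where "c = 2 ^ N"
  have c: "c > 0" by (simp add: c_def)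
  define g where "g k = f (grid N k)" for k
  have g: "k < l \<Longrightarrow> g k < g l" "k \<le> l \<Longrightarrow> g k \<le> g l" for k l
    by (auto simp: g_def less_iff le_iff grid_def divide_strict_right_mono divide_right_mono)
  have I: "interpolant N f r = g \<lfloor>c * r\<rfloor> + (c * r - of_int \<lfloor>c * r\<rfloor>) * (g (\<lfloor>c * r\<rfloor> + 1) - g \<lfloor>c * r\<rfloor>)"
    for r
    by (simp add: interpolant_def Let_def g_def c_def grid_def right_diff_distrib)
  define k where "k = \<lfloor>c * s\<rfloor>"
  define l where "l = \<lfloor>c * t\<rfloor>"
  have cst: "c * s < c * t" using c \<open>s < t\<close> by simp
  then have "k \<le> l" unfolding k_def l_def by (intro floor_mono) simp
  show "interpolant N f s < interpolant N f t"
  proof (cases "k = l")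
    case True
    have "(c * s - of_int k) * (g (k + 1) - g k) < (c * t - of_int k) * (g (k + 1) - g k)"
      using cst g(1)[of k "k + 1"] by (intro mult_strict_right_mono) auto
    then show ?thesis
      using True by (simp add: I flip: k_def l_def)
  next
    case False
    \<comment> \<open>The fractional part of \<open>c * s\<close> is below 1, so the value at
      \<open>s\<close> stays below the value at the right end of its cell.\<close>
    have "(c * s - of_int k) * (g (k + 1) - g k) < 1 * (g (k + 1) - g k)"
      unfolding k_def using g(1)[of k "k + 1"] by (intro mult_strict_right_mono) (linarith, simp add: k_def)
    then have "interpolant N f s < g (k + 1)"
      by (simp add: I flip: k_def)
    also have "g (k + 1) \<le> g l"
      using False \<open>k \<le> l\<close> by (intro g) simp
    also have "g l \<le> interpolant N f t"
      using g(1)[of l "l + 1"] by (simp add: I l_def)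
    finally show ?thesis .
  qed
qed

text \<open>The generalized inverse of \<open>x\<close> locates a cell whose end values enclose
  \<open>x\<close>; on that cell an affine equation is solved.\<close>

lemma interpolant_surj: "surj (interpolant N f)"
proof -
  have "\<exists>t. interpolant N f t = x" for x
  proof -
    define s where "s = generalized_inverse f x"
    define k0 where "k0 = \<lfloor>2 ^ N * s\<rfloor>"
    have k0: "grid N (k0 - 1) < s" "grid N k0 \<le> s" "s < grid N (k0 + 1)"
      unfolding grid_def k0_def by (simp_all add: field_simps; linarith)+
    have "\<exists>k. f (grid N (k - 1)) \<le> x \<and> x \<le> f (grid N k)"
    \<comment> \<open>If \<open>grid N k0\<close> equals \<open>s\<close>, the order relations for
      the generalized inverse do not decide on which side of \<open>x\<close> its value lies. The
      neighbouring grid points are strictly on either side of \<open>s\<close>, so one of the two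
      cells at \<open>grid N k0\<close> always works.\<close>
    proof (cases "f (grid N k0) \<le> x")
      case True
      then show ?thesis
        using less_of_generalized_inverse_less[of x "grid N (k0 + 1)"] k0
        by (intro exI[of _ "k0 + 1"]) (auto simp: s_def)
    next
      case False
      then show ?thesis
        using less_of_less_generalized_inverse[of "grid N (k0 - 1)" x] k0
        by (intro exI[of _ k0]) (auto simp: s_def)
    qed
    then obtain k where k: "f (grid N (k - 1)) \<le> x" "x \<le> f (grid N k)"
      by blast
    define d where "d = f (grid N k) - f (grid N (k - 1))"
    have d: "d > 0"
      by (simp add: d_def less_iff grid_def divide_strict_right_mono)
    define t where "t = grid N (k - 1) + (x - f (grid N (k - 1))) / d / 2 ^ N"
    have q: "0 \<le> (x - f (grid N (k - 1))) / d" "(x - f (grid N (k - 1))) / d \<le> 1"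
      using k d by (auto simp: d_def)
    have "grid N k = grid N (k - 1) + 1 / 2 ^ N"
      by (simp add: grid_def field_simps)
    then have "t \<in> {grid N (k - 1)..grid N k}"
      using q unfolding t_def atLeastAtMost_iff by (auto simp del: divide_divide_eq_left intro!: divide_right_mono)
    from interpolant_affine[OF this, of f] have "interpolant N f t = x"
      using d by (simp add: t_def flip: d_def)
    then show ?thesis ..
  qed
  then show ?thesis
    unfolding surj_def by metis
qed

text \<open>Applying the increasing interpolant to both sides turns a bound on the inverse into a
  condition at one fixed time. Such a condition can be checked at dyadic points and is measurable in
  the sample point.\<close>

lemma inv_interpolant_less_iff: "inv (interpolant N f) x < t \<longleftrightarrow> x < interpolant N f t"
  using strict_mono_less[OF interpolant_strict_mono, of N "inv (interpolant N f) x" t]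
  by (simp add: surj_f_inv_f[OF interpolant_surj])

lemma less_inv_interpolant_iff: "t < inv (interpolant N f) x \<longleftrightarrow> interpolant N f t < x"
  using strict_mono_less[OF interpolant_strict_mono, of N t "inv (interpolant N f) x"]
  by (simp add: surj_f_inv_f[OF interpolant_surj])

text \<open>A dyadic point between \<open>a\<close> and the generalized inverse carries the
  comparison of \<open>f\<close> with \<open>x\<close> over to all sufficiently fine interpolants.
  No \<open>x\<close> is exceptional, even one that \<open>f\<close> jumps over.\<close>

lemma inv_interpolant_tendsto:
  "(\<lambda>N. inv (interpolant N f) x) \<longlonglongrightarrow> generalized_inverse f x"
proof (rule order_tendstoI)
  fix a assume "a < generalized_inverse f x"
  then obtain m k where mk: "a < grid m k" "grid m k < generalized_inverse f x"
    by (rule grid_dense)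
  show "\<forall>\<^sub>F N in sequentially. a < inv (interpolant N f) x"
    using eventually_ge_at_top[of m]
  proof eventually_elim
    case (elim N)
    then have "grid m k < inv (interpolant N f) x"
      using less_of_less_generalized_inverse[OF mk(2)]
      by (simp add: less_inv_interpolant_iff interpolant_grid_refine)
    with mk show ?case by simp
  qed
next
  fix a assume "generalized_inverse f x < a"
  then obtain m k where mk: "generalized_inverse f x < grid m k" "grid m k < a"
    by (rule grid_dense)
  show "\<forall>\<^sub>F N in sequentially. inv (interpolant N f) x < a"
    using eventually_ge_at_top[of m]
  proof eventually_elim
    case (elim N)
    then have "inv (interpolant N f) x < grid m k"
      using less_of_generalized_inverse_less[OF mk(1)]
      by (simp add: inv_interpolant_less_iff interpolant_grid_refine)
    with mk show ?case by simp
  qed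
qed

text \<open>Continuity at \<open>r\<close> provides dyadic points on both sides of \<open>r\<close>
  with values close to \<open>f r\<close>. Eventually \<open>s N\<close> lies between them, and
  monotonicity of the interpolants transfers the bounds.\<close>

lemma interpolant_tendsto:
  assumes s: "s \<longlonglongrightarrow> r" and cont: "isCont f r"
  shows "(\<lambda>N. interpolant N f (s N)) \<longlonglongrightarrow> f r"
proof (rule order_tendstoI)
  fix a assume "a < f r"
  then have "\<forall>\<^sub>F t in at r. a < f t"
    by (rule order_tendstoD(1)[OF cont[unfolded isCont_def]])
  then obtain d where d: "d > 0" "\<And>t. t \<noteq> r \<Longrightarrow> dist t r < d \<Longrightarrow> a < f t"
    by (auto simp: eventually_at)
  obtain m k where mk: "r - d < grid m k" "grid m k < r"
    using grid_dense[of "r - d" r] d by auto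
  have "a < f (grid m k)"
    using mk by (intro d) (auto simp: dist_real_def)
  have "\<forall>\<^sub>F N in sequentially. grid m k < s N"
    using s mk(2) by (rule order_tendstoD)
  with eventually_ge_at_top[of m] show "\<forall>\<^sub>F N in sequentially. a < interpolant N f (s N)"
  proof eventually_elim
    case (elim N)
    then have "f (grid m k) < interpolant N f (s N)"
      using strict_monoD[OF interpolant_strict_mono, of "grid m k" "s N" N]
      by (simp add: interpolant_grid_refine)
    with \<open>a < f (grid m k)\<close> show ?case by simp
  qed
next
  fix a assume "f r < a"
  then have "\<forall>\<^sub>F t in at r. f t < a"
    by (rule order_tendstoD(2)[OF cont[unfolded isCont_def]])
  then obtain d where d: "d > 0" "\<And>t. t \<noteq> r \<Longrightarrow> dist t r < d \<Longrightarrow> f t < a"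
    by (auto simp: eventually_at)
  obtain m k where mk: "r < grid m k" "grid m k < r + d"
    using grid_dense[of r "r + d"] d by auto
  have "f (grid m k) < a"
    using mk by (intro d) (auto simp: dist_real_def)
  have "\<forall>\<^sub>F N in sequentially. s N < grid m k"
    using s mk(1) by (rule order_tendstoD)
  with eventually_ge_at_top[of m] show "\<forall>\<^sub>F N in sequentially. interpolant N f (s N) < a"
  proof eventually_elim
    case (elim N)
    then have "interpolant N f (s N) < f (grid m k)"
      using strict_monoD[OF interpolant_strict_mono, of "s N" "grid m k" N]
      by (simp add: interpolant_grid_refine)
    with \<open>f (grid m k) < a\<close> show ?case by simp
  qed
qed

lemma Gamma_N_tendsto_AE:
  "AE (x, t) in lborel. (\<lambda>N. Gamma_N N f 0 x t) \<longlonglongrightarrow> Gamma_lim f 0 x t"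
proof -
  define D where "D = {r. \<not> isCont f r}"
  have "countable D"
    unfolding D_def using strict by (intro mono_ctble_discont strict_mono_mono)
  then have D[measurable]: "D \<in> sets borel"
    using null_setsD2[OF countable_imp_null_set_lborel] by simp
  have [measurable]: "generalized_inverse f \<in> borel_measurable borel"
    using generalized_inverse_mono by (rule borel_measurable_mono)
  have "AE x in lborel. AE t in lborel. generalized_inverse f x - t \<notin> D"
  proof (rule AE_I2)
    fix x
    \<comment> \<open>For fixed \<open>x\<close> the bad times are a reflected translate of the jump
      set, hence countable and null.\<close>
    have "{t. generalized_inverse f x - t \<in> D} = (\<lambda>r. generalized_inverse f x - r) ` D"
      by (auto simp: image_iff intro!: bexI[of _ "generalized_inverse f x - _"])
    then have "countable {t. generalized_inverse f x - t \<in> D}"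
      using \<open>countable D\<close> by simp
    then show "AE t in lborel. generalized_inverse f x - t \<notin> D"
      by (intro AE_I'[OF countable_imp_null_set_lborel]) auto
  qed
  \<comment> \<open>Fubini's theorem needs a measurable set. It is applied to the condition of
    avoiding \<open>D\<close>, not to the convergence set itself.\<close>
  moreover have "{z \<in> space (lborel \<Otimes>\<^sub>M lborel). generalized_inverse f (fst z) - snd z \<notin> D}
      \<in> sets (lborel \<Otimes>\<^sub>M lborel)"
    by measurable
  ultimately have "AE z in lborel \<Otimes>\<^sub>M lborel. generalized_inverse f (fst z) - snd z \<notin> D"
    by (intro lborel_pair.AE_pair_measure) simp_all
  then have "AE z in lborel. generalized_inverse f (fst z) - snd z \<notin> D"
    unfolding lborel_prod .
  then show ?thesis
  proof eventually_elim
    case (elim z)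
    obtain x t where z: "z = (x, t)" by (cases z)
    have "(\<lambda>N. 0 + inv (interpolant N f) x - t) \<longlonglongrightarrow> 0 + generalized_inverse f x - t"
      by (intro tendsto_intros inv_interpolant_tendsto)
    then show ?case
      using elim unfolding z Gamma_N_def Gamma_lim_def prod.case
      by (intro interpolant_tendsto) (auto simp: D_def)
  qed
qed

end

section \<open>Joint measurability when every path is good, and convergence on the product
  space\<close>

locale increasing_process =
  fixes M :: "'a measure" and Y :: "'a \<Rightarrow> real \<Rightarrow> real"
  assumes path: "\<And>\<omega>. increasing_path (Y \<omega>)"
    and right_continuous: "\<And>\<omega> t. continuous (at_right t) (Y \<omega>)"
    and measurable_Y[measurable]: "\<And>t. (\<lambda>\<omega>. Y \<omega> t) \<in> borel_measurable M"
begin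

text \<open>The floor takes only countably many values, so measurability at fixed times suffices
  here, before joint measurability of \<open>Y\<close> is known.\<close>

lemma measurable_grid_floor[measurable]:
  "(\<lambda>(\<omega>, t::real). Y \<omega> (grid N (\<lfloor>2 ^ N * t\<rfloor> + j))) \<in> borel_measurable (M \<Otimes>\<^sub>M borel)"
proof -
  have "(\<lambda>z. (\<lambda>i z. Y (fst z) (grid N (i + j))) \<lfloor>2 ^ N * (snd z :: real)\<rfloor> z) \<in> borel_measurable (M \<Otimes>\<^sub>M borel)"
    by (rule measurable_compose_countable) measurable
  then show ?thesis
    by (simp add: split_beta')
qed

lemma measurable_interpolant[measurable]:
  "(\<lambda>(\<omega>, t). interpolant N (Y \<omega>) t) \<in> borel_measurable (M \<Otimes>\<^sub>M borel)"
proof -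
  define g where "g j = (\<lambda>(\<omega>, t::real). Y \<omega> (grid N (\<lfloor>2 ^ N * t\<rfloor> + j)))" for j
  have [measurable]: "g j \<in> borel_measurable (M \<Otimes>\<^sub>M borel)" for j
    unfolding g_def by (rule measurable_grid_floor)
  have "(\<lambda>(\<omega>, t). interpolant N (Y \<omega>) t) =
      (\<lambda>z. g 0 z + 2 ^ N * (snd z - of_int \<lfloor>2 ^ N * snd z\<rfloor> / 2 ^ N) * (g 1 z - g 0 z))"
    by (simp add: interpolant_def Let_def fun_eq_iff g_def grid_def)
  also have "\<dots> \<in> borel_measurable (M \<Otimes>\<^sub>M borel)"
    by measurable
  finally show ?thesis .
qed

text \<open>By right-continuity the path is the pointwise limit of its values at the grid points
  just to the right of \<open>t\<close>, which are jointly measurable.\<close>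

lemma measurable_path[measurable]:
  "(\<lambda>(\<omega>, t). Y \<omega> t) \<in> borel_measurable (M \<Otimes>\<^sub>M borel)"
proof (rule borel_measurable_LIMSEQ_real)
  fix z :: "'a \<times> real"
  obtain \<omega> t where z: "z = (\<omega>, t)" by (cases z)
  have "(\<lambda>N. (1 / 2 :: real) ^ N) \<longlonglongrightarrow> 0"
    by (rule LIMSEQ_power_zero) simp
  from tendsto_add[OF tendsto_const[of t] this] have lim: "(\<lambda>N. t + (1 / 2) ^ N) \<longlonglongrightarrow> t"
    by simp
  have "(\<lambda>N. grid N (\<lfloor>2 ^ N * t\<rfloor> + 1)) \<longlonglongrightarrow> t"
    by (rule tendsto_sandwich[OF _ _ tendsto_const[of t] lim])
      (simp_all add: grid_floor_bounds less_imp_le)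
  moreover have "\<forall>\<^sub>F N in sequentially. grid N (\<lfloor>2 ^ N * t\<rfloor> + 1) \<in> {t<..}"
    by (simp add: grid_floor_bounds)
  ultimately have "filterlim (\<lambda>N. grid N (\<lfloor>2 ^ N * t\<rfloor> + 1)) (at_right t) sequentially"
    by (rule tendsto_imp_filterlim_at_right[OF _ eventually_mono]) simp
  moreover have "(Y \<omega> \<longlongrightarrow> Y \<omega> t) (at_right t)"
    using right_continuous unfolding continuous_within .
  ultimately show "(\<lambda>N. (\<lambda>(\<omega>, t). Y \<omega> (grid N (\<lfloor>2 ^ N * t\<rfloor> + 1))) z) \<longlonglongrightarrow> (\<lambda>(\<omega>, t). Y \<omega> t) z"
    unfolding z prod.case by (rule filterlim_compose[rotated])
qed measurable

text \<open>Monotonicity allows the witness of a strict upper bound to be moved right to a rational,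
  so each sublevel set is a countable union of measurable sets.\<close>

lemma measurable_generalized_inverse[measurable]:
  "(\<lambda>(\<omega>, x). generalized_inverse (Y \<omega>) x) \<in> borel_measurable (M \<Otimes>\<^sub>M borel)"
proof (rule borel_measurableI_less)
  fix s
  have "generalized_inverse (Y \<omega>) x < s \<longleftrightarrow> (\<exists>q::rat. of_rat q < s \<and> x \<le> Y \<omega> (of_rat q))" for \<omega> x
  proof -
    have "\<exists>q::rat. of_rat q < s \<and> x \<le> Y \<omega> (of_rat q)" if t: "t < s" "x \<le> Y \<omega> t" for t
    proof -
      obtain q where "t < of_rat q" "of_rat q < s"
        using of_rat_dense[OF t(1)] by blast
      moreover have "Y \<omega> t \<le> Y \<omega> (of_rat q)"
        using \<open>t < of_rat q\<close> increasing_path.le_iff[OF path] by simp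
      ultimately show ?thesis
        using t(2) by (auto intro: order_trans)
    qed
    then show ?thesis
      unfolding increasing_path.generalized_inverse_less_iff[OF path] by auto
  qed
  then have "{z \<in> space (M \<Otimes>\<^sub>M borel). (\<lambda>(\<omega>, x). generalized_inverse (Y \<omega>) x) z < s} =
      {z \<in> space (M \<Otimes>\<^sub>M borel). \<exists>q::rat. of_rat q < s \<and> snd z \<le> Y (fst z) (of_rat q)}"
    by (simp add: split_beta')
  also have "\<dots> \<in> sets (M \<Otimes>\<^sub>M borel)"
    by measurable
  finally show "{z \<in> space (M \<Otimes>\<^sub>M borel). (\<lambda>(\<omega>, x). generalized_inverse (Y \<omega>) x) z < s}
      \<in> sets (M \<Otimes>\<^sub>M borel)" .
qed

lemma measurable_inv_interpolant[measurable]: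
  "(\<lambda>(\<omega>, x). inv (interpolant N (Y \<omega>)) x) \<in> borel_measurable (M \<Otimes>\<^sub>M borel)"
proof (rule borel_measurableI_less)
  fix s
  have [measurable]: "(\<lambda>\<omega>. interpolant N (Y \<omega>) s) \<in> borel_measurable M"
    unfolding interpolant_def Let_def by measurable
  have "{z \<in> space (M \<Otimes>\<^sub>M borel). (\<lambda>(\<omega>, x). inv (interpolant N (Y \<omega>)) x) z < s} =
      {z \<in> space (M \<Otimes>\<^sub>M borel). snd z < interpolant N (Y (fst z)) s}"
    by (simp add: split_beta' increasing_path.inv_interpolant_less_iff[OF path])
  also have "\<dots> \<in> sets (M \<Otimes>\<^sub>M borel)"
    by measurable
  finally show "{z \<in> space (M \<Otimes>\<^sub>M borel). (\<lambda>(\<omega>, x). inv (interpolant N (Y \<omega>)) x) z < s}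
      \<in> sets (M \<Otimes>\<^sub>M borel)" .
qed

lemma measurable_Gamma_N[measurable]:
  "(\<lambda>(\<omega>, x, t). Gamma_N N (Y \<omega>) \<tau> x t) \<in> borel_measurable (M \<Otimes>\<^sub>M borel)"
proof -
  have "(\<lambda>z. (\<lambda>(\<omega>, t). interpolant N (Y \<omega>) t)
      (fst z, \<tau> + (\<lambda>(\<omega>, x). inv (interpolant N (Y \<omega>)) x) (fst z, fst (snd z)) - snd (snd z)))
    \<in> borel_measurable (M \<Otimes>\<^sub>M borel \<Otimes>\<^sub>M borel)"
    by measurable
  then show ?thesis
    by (simp add: Gamma_N_def split_beta' borel_prod)
qed

lemma measurable_Gamma_lim[measurable]:
  "(\<lambda>(\<omega>, x, t). Gamma_lim (Y \<omega>) \<tau> x t) \<in> borel_measurable (M \<Otimes>\<^sub>M borel)"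
proof -
  have "(\<lambda>z. (\<lambda>(\<omega>, t). Y \<omega> t)
      (fst z, \<tau> + (\<lambda>(\<omega>, x). generalized_inverse (Y \<omega>) x) (fst z, fst (snd z)) - snd (snd z)))
    \<in> borel_measurable (M \<Otimes>\<^sub>M borel \<Otimes>\<^sub>M borel)"
    by measurable
  then show ?thesis
    by (simp add: Gamma_lim_def split_beta' borel_prod)
qed

text \<open>Every \<omega>-section of the convergence set has full measure. Joint measurability of
  the curves makes that set measurable, so Fubini's theorem applies.\<close>

lemma Gamma_N_tendsto_AE_pair:
  assumes "sigma_finite_measure M"
  shows "AE (\<omega>, x, t) in M \<Otimes>\<^sub>M lborel.
     (\<lambda>N. Gamma_N N (Y \<omega>) 0 x t) \<longlonglongrightarrow> Gamma_lim (Y \<omega>) 0 x t"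
proof -
  interpret pair_sigma_finite M "lborel :: (real \<times> real) measure"
    using assms by (simp add: pair_sigma_finite_def lborel.sigma_finite_measure_axioms)
  have "{z \<in> space (M \<Otimes>\<^sub>M lborel). (\<lambda>N. (\<lambda>(\<omega>, x, t). Gamma_N N (Y \<omega>) 0 x t) z)
      \<longlonglongrightarrow> (\<lambda>(\<omega>, x, t). Gamma_lim (Y \<omega>) 0 x t) z} \<in> sets (M \<Otimes>\<^sub>M lborel)"
    by measurable
  then show ?thesis
    using increasing_path.Gamma_N_tendsto_AE[OF path]
    by (intro AE_pair_measure) (auto simp: split_beta')
qed

end

text \<open>Dominated convergence with the constant \<open>(2 * B) powr p\<close> on a set of finite
  measure. The space \<open>S\<close> is arbitrary so as to cover both the plane and the product
  with the probability space. Integrability is part of the conclusion because the integral of a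
  non-integrable function is 0 by convention.\<close>

lemma Lp_diff_tendsto_0:
  fixes u :: "real \<Rightarrow> real" and p :: real and S :: "'b measure"
  assumes u: "bounded (range u)" "continuous_on UNIV u" and p: "0 < p"
    and A: "A \<in> sets S" "emeasure S A < \<infinity>"
    and meas[measurable]: "\<And>N. g N \<in> borel_measurable S" "h \<in> borel_measurable S"
    and lim: "AE z in S. (\<lambda>N. g N z) \<longlonglongrightarrow> h z"
  shows "(\<forall>N. set_integrable S A (\<lambda>z. \<bar>u (g N z) - u (h z)\<bar> powr p)) \<and>
    (\<lambda>N. LINT z:A|S. \<bar>u (g N z) - u (h z)\<bar> powr p) \<longlonglongrightarrow> 0"
proof -
  obtain B where B: "\<And>y. \<bar>u y\<bar> \<le> B"
    using u(1) by (auto simp: bounded_iff)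
  have [measurable]: "u \<in> borel_measurable borel"
    using u(2) by (rule borel_measurable_continuous_onI)
  note A(1)[measurable]
  have bound: "\<bar>u y - u y'\<bar> powr p \<le> (2 * B) powr p" for y y'
    using B[of y] B[of y'] p by (intro powr_mono2) auto
  let ?F = "\<lambda>N z. indicator A z *\<^sub>R (\<bar>u (g N z) - u (h z)\<bar> powr p)"
  let ?W = "\<lambda>z. indicator A z * (2 * B) powr p"
  have W: "integrable S ?W"
    using A by (intro integrable_mult_left) auto
  have dom: "AE z in S. norm (?F N z) \<le> ?W z" for N
    using bound by (auto simp: indicator_def)
  have "integrable S (?F N)" for N
    using dom[of N] by (intro Bochner_Integration.integrable_bound[OF W]) auto
  moreover have "AE z in S. (\<lambda>N. ?F N z) \<longlonglongrightarrow> 0"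
    using lim
  proof eventually_elim
    case (elim z)
    have "(\<lambda>N. u (g N z)) \<longlonglongrightarrow> u (h z)"
      using u(2) elim by (intro continuous_on_tendsto_compose[OF u(2)]) auto
    then have "(\<lambda>N. \<bar>u (g N z) - u (h z)\<bar> powr p) \<longlonglongrightarrow> 0"
      using p by (intro tendsto_zero_powrI[OF _ tendsto_const]) 
        (auto intro!: tendsto_rabs_zero simp: LIM_zero)
    then show ?case
      using tendsto_scaleR[OF tendsto_const] by force
  qed
  then have "(\<lambda>N. integral\<^sup>L S (?F N)) \<longlonglongrightarrow> integral\<^sup>L S (\<lambda>_. 0)"
    using dom by (intro integral_dominated_convergence[OF _ _ W]) auto
  ultimately show ?thesis
    by (simp add: set_integrable_def set_lebesgue_integral_def)
qed

section \<open>Transfer from the modified process to the original one\<close>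

theorem proposition3p3:
  fixes M :: "'a measure" and X :: "real \<Rightarrow> 'a \<Rightarrow> real" and \<Omega>0 :: "'a set"
  assumes levy: "levy_process M X"
    and positive_increments: "\<And>s t. s < t \<Longrightarrow> AE \<omega> in M. X t \<omega> - X s \<omega> > 0"
    and event: "\<Omega>0 \<in> sets M" "measure M \<Omega>0 = 1"
    and cadlag: "\<And>\<omega>. \<omega> \<in> \<Omega>0 \<Longrightarrow> cadlag (\<lambda>t. X t \<omega>)"
    and increasing: "\<And>\<omega>. \<omega> \<in> \<Omega>0 \<Longrightarrow> strict_mono (\<lambda>t. X t \<omega>)"
    and at_top: "\<And>\<omega>. \<omega> \<in> \<Omega>0 \<Longrightarrow> filterlim (\<lambda>t. X t \<omega>) at_top at_top"
    and at_bot: "\<And>\<omega>. \<omega> \<in> \<Omega>0 \<Longrightarrow> filterlim (\<lambda>t. X t \<omega>) at_bot at_bot"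
  shows
    "(\<forall>\<omega>\<in>\<Omega>0. AE (x, t) in lborel.
        (\<lambda>N. Gamma_N N (\<lambda>s. X s \<omega>) 0 x t) \<longlonglongrightarrow> Gamma_lim (\<lambda>s. X s \<omega>) 0 x t)
   \<and> (\<forall>(u0 :: real \<Rightarrow> real) (p :: real) (K :: (real \<times> real) set).
        bounded (range u0) \<longrightarrow> continuous_on UNIV u0 \<longrightarrow> 1 \<le> p \<longrightarrow> compact K \<longrightarrow>
        (\<forall>\<omega>\<in>\<Omega>0.
          (\<forall>N. set_integrable lborel K
                 (\<lambda>(x, t). \<bar>u0 (Gamma_N N (\<lambda>s. X s \<omega>) 0 x t)
                            - u0 (Gamma_lim (\<lambda>s. X s \<omega>) 0 x t)\<bar> powr p)) \<and>
          (\<lambda>N. LINT (x, t):K|lborel.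
                 \<bar>u0 (Gamma_N N (\<lambda>s. X s \<omega>) 0 x t)
                  - u0 (Gamma_lim (\<lambda>s. X s \<omega>) 0 x t)\<bar> powr p) \<longlonglongrightarrow> 0))
   \<and> (AE (\<omega>, x, t) in M \<Otimes>\<^sub>M lborel.
        (\<lambda>N. Gamma_N N (\<lambda>s. X s \<omega>) 0 x t) \<longlonglongrightarrow> Gamma_lim (\<lambda>s. X s \<omega>) 0 x t)
   \<and> (\<forall>(u0 :: real \<Rightarrow> real) (p :: real) (K :: (real \<times> real) set).
        bounded (range u0) \<longrightarrow> continuous_on UNIV u0 \<longrightarrow> 1 \<le> p \<longrightarrow> compact K \<longrightarrow>
          (\<forall>N. set_integrable (M \<Otimes>\<^sub>M lborel) (\<Omega>0 \<times> K)
                 (\<lambda>(\<omega>, x, t). \<bar>u0 (Gamma_N N (\<lambda>s. X s \<omega>) 0 x t)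
                               - u0 (Gamma_lim (\<lambda>s. X s \<omega>) 0 x t)\<bar> powr p)) \<and>
          (\<lambda>N. LINT (\<omega>, x, t):\<Omega>0 \<times> K|M \<Otimes>\<^sub>M lborel.
                 \<bar>u0 (Gamma_N N (\<lambda>s. X s \<omega>) 0 x t)
                  - u0 (Gamma_lim (\<lambda>s. X s \<omega>) 0 x t)\<bar> powr p) \<longlonglongrightarrow> 0)"
proof -
  interpret levy_process M X by (rule levy)
  note sigma_finite_M = sigma_finite_measure_axioms
  interpret pair_sigma_finite M "lborel :: (real \<times> real) measure" ..
  \<comment> \<open>The paths off \<open>\<Omega>0\<close> are replaced by the identity, so that every path is good.\<close>
  define Y where "Y \<omega> = (if \<omega> \<in> \<Omega>0 then (\<lambda>s. X s \<omega>) else (\<lambda>s. s))" for \<omega>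
  have Y: "Y \<omega> = (\<lambda>s. X s \<omega>)" if "\<omega> \<in> \<Omega>0" for \<omega>
    using that by (simp add: Y_def)
  note event(1)[measurable] random_variable_X[measurable]
  interpret increasing_process M Y
  proof (rule increasing_process.intro)
    show "increasing_path (Y \<omega>)" for \<omega>
      using increasing at_top at_bot
      by (auto simp: Y_def increasing_path_def strict_mono_def filterlim_ident)
    show "continuous (at_right t) (Y \<omega>)" for \<omega> t
      using cadlag by (auto simp: Y_def cadlag_def)
    show "(\<lambda>\<omega>. Y \<omega> t) \<in> borel_measurable M" for t
      unfolding Y_def if_distrib[of "\<lambda>f. f t"] by measurable
  qed
  have good: "AE \<omega> in M. \<omega> \<in> \<Omega>0"
    using event by (subst prob_eq_1[symmetric]) auto
  \<comment> \<open>Almost sure goodness is lifted to the product, so that \<open>Y\<close> can be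
    replaced by \<open>X\<close> almost everywhere there.\<close>
  have "{z \<in> space (M \<Otimes>\<^sub>M (lborel :: (real \<times> real) measure)). fst z \<in> \<Omega>0} \<in> sets (M \<Otimes>\<^sub>M lborel)"
    by measurable
  then have "AE z in M \<Otimes>\<^sub>M (lborel :: (real \<times> real) measure). fst z \<in> \<Omega>0"
    using good by (intro AE_pair_measure) (auto elim!: eventually_mono)
  with Gamma_N_tendsto_AE_pair[OF sigma_finite_M] have pair_conv:
    "AE (\<omega>, x, t) in M \<Otimes>\<^sub>M lborel.
       (\<lambda>N. Gamma_N N (\<lambda>s. X s \<omega>) 0 x t) \<longlonglongrightarrow> Gamma_lim (\<lambda>s. X s \<omega>) 0 x t"
    by eventually_elim (auto simp: Y)
  have path_conv:
    "AE (x, t) in lborel. (\<lambda>N. Gamma_N N (\<lambda>s. X s \<omega>) 0 x t) \<longlonglongrightarrow> Gamma_lim (\<lambda>s. X s \<omega>) 0 x t"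
    if "\<omega> \<in> \<Omega>0" for \<omega>
    using increasing_path.Gamma_N_tendsto_AE[OF path, of \<omega>] that by (simp add: Y)
  have Lp_path:
    "(\<forall>N. set_integrable lborel K
        (\<lambda>(x, t). \<bar>u0 (Gamma_N N (\<lambda>s. X s \<omega>) 0 x t)
                   - u0 (Gamma_lim (\<lambda>s. X s \<omega>) 0 x t)\<bar> powr p)) \<and>
     (\<lambda>N. LINT (x, t):K|lborel.
        \<bar>u0 (Gamma_N N (\<lambda>s. X s \<omega>) 0 x t)
         - u0 (Gamma_lim (\<lambda>s. X s \<omega>) 0 x t)\<bar> powr p) \<longlonglongrightarrow> 0"
    if "bounded (range u0)" "continuous_on UNIV u0" "1 \<le> p" "compact K" "\<omega> \<in> \<Omega>0"
    for u0 :: "real \<Rightarrow> real" and p :: real and K :: "(real \<times> real) set" and \<omega>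
  proof -
    have \<omega>: "\<omega> \<in> space M"
      using that event(1) sets.sets_into_space by blast
    have "(\<lambda>(x, t). Gamma_N N (\<lambda>s. X s \<omega>) 0 x t) \<in> borel_measurable lborel" for N
      \<comment> \<open>For fixed \<omega>, measurability in the plane is inherited by sections of
        the jointly measurable curves of \<open>Y\<close>.\<close>
      using measurable_Pair2[OF measurable_Gamma_N \<omega>, of N 0] that by (simp add: Y)
    moreover have "(\<lambda>(x, t). Gamma_lim (\<lambda>s. X s \<omega>) 0 x t) \<in> borel_measurable lborel"
      using measurable_Pair2[OF measurable_Gamma_lim \<omega>, of 0] that by (simp add: Y)
    ultimately show ?thesis
      using Lp_diff_tendsto_0[OF that(1,2), of p K lborel
          "\<lambda>N (x, t). Gamma_N N (\<lambda>s. X s \<omega>) 0 x t" "\<lambda>(x, t). Gamma_lim (\<lambda>s. X s \<omega>) 0 x t"]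
        path_conv[OF that(5)] that(3,4) emeasure_compact_finite[OF that(4)] borel_compact[OF that(4)]
      by (simp add: split_beta')
  qed
  have Lp_pair:
    "(\<forall>N. set_integrable (M \<Otimes>\<^sub>M lborel) (\<Omega>0 \<times> K)
        (\<lambda>(\<omega>, x, t). \<bar>u0 (Gamma_N N (\<lambda>s. X s \<omega>) 0 x t)
                      - u0 (Gamma_lim (\<lambda>s. X s \<omega>) 0 x t)\<bar> powr p)) \<and>
     (\<lambda>N. LINT (\<omega>, x, t):\<Omega>0 \<times> K|M \<Otimes>\<^sub>M lborel.
        \<bar>u0 (Gamma_N N (\<lambda>s. X s \<omega>) 0 x t)
         - u0 (Gamma_lim (\<lambda>s. X s \<omega>) 0 x t)\<bar> powr p) \<longlonglongrightarrow> 0"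
    if "bounded (range u0)" "continuous_on UNIV u0" "1 \<le> p" "compact K"
    for u0 :: "real \<Rightarrow> real" and p :: real and K :: "(real \<times> real) set"
  proof -
    let ?F = "\<lambda>Z N (\<omega>, x, t). \<bar>u0 (Gamma_N N (Z \<omega>) 0 x t) - u0 (Gamma_lim (Z \<omega>) 0 x t)\<bar> powr p"
    let ?X = "\<lambda>\<omega> s. X s \<omega>"
    have K: "K \<in> sets lborel"
      using borel_compact[OF that(4)] by simp
    have A: "\<Omega>0 \<times> K \<in> sets (M \<Otimes>\<^sub>M lborel)"
      using event(1) K by auto
    have "emeasure (M \<Otimes>\<^sub>M lborel) (\<Omega>0 \<times> K) = emeasure M \<Omega>0 * emeasure lborel K"
      using event(1) K by (rule lborel.emeasure_pair_measure_Times)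
    also have "\<dots> < \<infinity>"
      using emeasure_compact_finite[OF that(4)] emeasure_eq_measure[of \<Omega>0] event(2)
      by (simp add: ennreal_mult_less_top)
    finally have fin: "emeasure (M \<Otimes>\<^sub>M lborel) (\<Omega>0 \<times> K) < \<infinity>" .
    \<comment> \<open>The limit theorem is applied to \<open>Y\<close>, whose curves are measurable
      on the whole product; \<open>X\<close> is substituted only afterwards, since the integrands
      agree on \<open>\<Omega>0 \<times> K\<close>.\<close>
    have *: "(\<forall>N. set_integrable (M \<Otimes>\<^sub>M lborel) (\<Omega>0 \<times> K) (?F Y N)) \<and>
        (\<lambda>N. LINT z:\<Omega>0 \<times> K|M \<Otimes>\<^sub>M lborel. ?F Y N z) \<longlonglongrightarrow> 0"
      using Lp_diff_tendsto_0[OF that(1,2) _ A fin, of p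
          "\<lambda>N (\<omega>, x, t). Gamma_N N (Y \<omega>) 0 x t" "\<lambda>(\<omega>, x, t). Gamma_lim (Y \<omega>) 0 x t"]
        Gamma_N_tendsto_AE_pair[OF sigma_finite_M] measurable_Gamma_N measurable_Gamma_lim that(3)
      by (simp add: split_beta')
    have eq: "?F Y N z = ?F ?X N z" if "z \<in> \<Omega>0 \<times> K" for N z
      using that by (auto simp: Y)
    have "set_integrable (M \<Otimes>\<^sub>M lborel) (\<Omega>0 \<times> K) (?F Y N) \<longleftrightarrow>
        set_integrable (M \<Otimes>\<^sub>M lborel) (\<Omega>0 \<times> K) (?F ?X N)" for N
      using eq by (intro set_integrable_cong) auto
    moreover have "(LINT z:\<Omega>0 \<times> K|M \<Otimes>\<^sub>M lborel. ?F Y N z) =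
        (LINT z:\<Omega>0 \<times> K|M \<Otimes>\<^sub>M lborel. ?F ?X N z)" for N
      using eq A by (intro set_lebesgue_integral_cong) auto
    ultimately show ?thesis
      using * by simp
  qed
  show ?thesis
    using path_conv pair_conv Lp_path Lp_pair by blast
qed

end
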